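(* For a link diagram $D$, we have the following (i) and (ii). (i) We have $$\sum_{i<j}|\mathrm{Link}(D^i,D^j)|\leq ld(D).$$ Further, the equality holds if and only if the under-crossings of $D^i$ in $D^i\cup D^j$ are all positive or all negative, with an orientation, for every subdiagram $D^i\cup D^j$ ($i<j$). (ii) We have $$\sum_{i<j}|\mathrm{Link}(D^i,D^j)|\equiv ld(D)\pmod 2.$$
   Context: $D$ is a diagram of an $r$-component link. Its components, i.e. the diagrams of the knot components of the link, are denoted $D^1,\dots,D^r$; for an unordered diagram $D$, the notations $D^i$ and $D^i\cup D^j$ denote subdiagrams of $D$ with an order. The under-crossings of $D^i$ in $D^i\cup D^j$ are the crossings between $D^i$ and $D^j$ at which $D^i$ is the under-strand. For a crossing point $p$ of an oriented diagram, $\varepsilon(p)=+1$ if $p$ is a positive crossing and $\varepsilon(p)=-1$ if $p$ is a negative crossing. For an oriented subdiagram $D^i\cup D^j$, the linking number is $\mathrm{Link}(D^i,D^j)=\frac12\sum_{p\in D^i\cap D^j}\varepsilon(p)$, the sum being over the crossings between $D^i$ and $D^j$. Linking warping degree: a base point sequence ${\bf a}=(a_1,\dots,a_r)$ of $D$ is an ordered sequence of points, exactly one on each component and none at a crossing point; with the order of ${\bf a}$ we write $D_{\bf a}=D^1_{a_1}\cup\dots\cup D^r_{a_r}$. For $i<j$, $d(D^i_{a_i},D^j_{a_j})$ is the number of crossings between $D^i$ and $D^j$ at which $D^i$ is the under-strand. Put $ld(D_{\bf a})=\sum_{i<j}d(D^i_{a_i},D^j_{a_j})$, and let $ld(D)$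 be the minimum of $ld(D_{\bf a})$ over all base point sequences ${\bf a}$ of $D$. It does not depend on the orientations of the components. *)

theory Defs
  imports "HOL-Analysis.Analysis" "HOL-Library.Real_Mod"
begin

text \<open>
  A link diagram is given by \<open>ncomp\<close> closed curves in the plane, indexed by
  \<open>{..<ncomp}\<close> and parametrized with period 1, together with the crossing information:
  \<open>over p\<close> is the over-strand at the crossing \<open>p\<close>, given as a pair of a component index
  and a parameter in \<open>[0, 1)\<close>. The values of \<open>over\<close> at other points are irrelevant.
\<close>

record link_diagram =
  ncomp :: nat
  curve :: "nat \<Rightarrow> real \<Rightarrow> complex"
  over :: "complex \<Rightarrow> nat \<times> real"

definition component :: "link_diagram \<Rightarrow> nat \<Rightarrow> complex set" where
  "component D i = range (curve D i)"

definition strands :: "link_diagram \<Rightarrow> complex \<Rightarrow> (nat \<times> real) set" where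
  "strands D p = {(i, t). i < ncomp D \<and> 0 \<le> t \<and> t < 1 \<and> curve D i t = p}"

definition crossings :: "link_diagram \<Rightarrow> complex set" where
  "crossings D = {p. card (strands D p) = 2}"

definition under :: "link_diagram \<Rightarrow> complex \<Rightarrow> nat \<times> real" where
  "under D p = (THE x. x \<in> strands D p \<and> x \<noteq> over D p)"

definition velocity :: "link_diagram \<Rightarrow> nat \<times> real \<Rightarrow> complex" where
  "velocity D = (\<lambda>(i, t). vector_derivative (curve D i) (at t))"

definition cross_prod :: "complex \<Rightarrow> complex \<Rightarrow> real" where
  "cross_prod v w = Re v * Im w - Im v * Re w"

text \<open>
  The curves are \<open>C\<^sup>1\<close> immersions whose only multiple points (self-crossings as well as
  crossings of different components) are finitely many transverse double points.
\<close>

definition is_link_diagram :: "link_diagram \<Rightarrow> bool" where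
  "is_link_diagram D \<longleftrightarrow>
     1 \<le> ncomp D \<and>
     (\<forall>i < ncomp D.
        curve D i C1_differentiable_on UNIV \<and>
        (\<forall>t. curve D i (t + 1) = curve D i t) \<and>
        (\<forall>t. velocity D (i, t) \<noteq> 0)) \<and>
     (\<forall>p. finite (strands D p) \<and> card (strands D p) \<le> 2) \<and>
     finite (crossings D) \<and>
     (\<forall>p. \<forall>x \<in> strands D p. \<forall>y \<in> strands D p.
        x \<noteq> y \<longrightarrow> cross_prod (velocity D x) (velocity D y) \<noteq> 0) \<and>
     (\<forall>p \<in> crossings D. over D p \<in> strands D p)"

text \<open>
  An orientation says for each component whether it is traversed in the direction of its
  parametrization (\<open>1\<close>) or against it (\<open>-1\<close>).
\<close>

definition is_orientation :: "link_diagram \<Rightarrow> (nat \<Rightarrow> real) \<Rightarrow> bool" where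
  "is_orientation D \<omega> \<longleftrightarrow> (\<forall>i < ncomp D. \<omega> i = 1 \<or> \<omega> i = -1)"

definition direction :: "link_diagram \<Rightarrow> (nat \<Rightarrow> real) \<Rightarrow> nat \<times> real \<Rightarrow> complex" where
  "direction D \<omega> x = \<omega> (fst x) *\<^sub>R velocity D x"

text \<open>
  A crossing is positive if the over-strand is turned to the under-strand counterclockwise
  by an angle less than \<open>\<pi>\<close>.
\<close>

definition crossing_sign :: "link_diagram \<Rightarrow> (nat \<Rightarrow> real) \<Rightarrow> complex \<Rightarrow> real" where
  "crossing_sign D \<omega> p =
     sgn (cross_prod (direction D \<omega> (over D p)) (direction D \<omega> (under D p)))"

text \<open>The following two definitions are meant for \<open>i \<noteq> j\<close>.\<close>

definition linking_number :: "link_diagram \<Rightarrow> (nat \<Rightarrow> real) \<Rightarrow> nat \<Rightarrow> nat \<Rightarrow> real" where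
  "linking_number D \<omega> i j =
     1 / 2 * (\<Sum>p \<in> component D i \<inter> component D j. crossing_sign D \<omega> p)"

definition under_crossings :: "link_diagram \<Rightarrow> nat \<Rightarrow> nat \<Rightarrow> complex set" where
  "under_crossings D i j = {p \<in> component D i \<inter> component D j. fst (under D p) = i}"

definition base_point_seq :: "link_diagram \<Rightarrow> complex list \<Rightarrow> bool" where
  "base_point_seq D a \<longleftrightarrow>
     length a = ncomp D \<and>
     (\<forall>p \<in> set a. p \<notin> crossings D) \<and>
     (\<forall>i < ncomp D. \<exists>!k. k < ncomp D \<and> a ! k \<in> component D i)"

definition component_of :: "link_diagram \<Rightarrow> complex \<Rightarrow> nat" where
  "component_of D p = (THE i. i < ncomp D \<and> p \<in> component D i)"

text \<open>
  A base point sequence orders the components: the \<open>k\<close>-th component is the one that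
  contains the \<open>k\<close>-th base point.
\<close>

definition ld_at :: "link_diagram \<Rightarrow> complex list \<Rightarrow> nat" where
  "ld_at D a =
     (\<Sum>j < ncomp D. \<Sum>i < j.
        card (under_crossings D (component_of D (a ! i)) (component_of D (a ! j))))"

definition ld :: "link_diagram \<Rightarrow> nat" where
  "ld D = (LEAST n. \<exists>a. base_point_seq D a \<and> n = ld_at D a)"

lemma component_strand:
  assumes "is_link_diagram D" "i < ncomp D" "p \<in> component D i"
  obtains t where "(i, t) \<in> strands D p"
proof -
  from assms(3) obtain s where s: "p = curve D i s" by (auto simp: component_def)
  have per: "curve D i (x + 1) = curve D i x" for x
    using assms unfolding is_link_diagram_def by blast
  have pern: "curve D i (x + of_nat n) = curve D i x" for x and n :: nat
  proof (induction n)
    case (Suc n) then show ?case using per[of "x + of_nat n"] by (simp add: algebra_simps)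
  qed simp
  have peri: "curve D i (x + of_int n) = curve D i x" for x and n :: int
  proof (cases "n \<ge> 0")
    case True then show ?thesis using pern[of x "nat n"] by simp
  next
    case False then show ?thesis using pern[of "x + of_int n" "nat (-n)"] by simp
  qed
  have "curve D i (frac s) = p" using peri[of "frac s" "\<lfloor>s\<rfloor>"] s by (simp add: frac_def)
  then have "(i, frac s) \<in> strands D p"
    using assms(2) by (simp add: strands_def frac_lt_1)
  then show thesis by (rule that)
qed

lemma crossing_of_components:
  assumes "is_link_diagram D" "i < ncomp D" "j < ncomp D" "i \<noteq> j"
    "p \<in> component D i" "p \<in> component D j"
  shows "p \<in> crossings D"
proof -
  obtain s t where st: "(i, s) \<in> strands D p" "(j, t) \<in> strands D p"
    using assms component_strand by metis
  have f: "finite (strands D p)" "card (strands D p) \<le> 2"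
    using assms(1) unfolding is_link_diagram_def by blast+
  have "card {(i, s), (j, t)} \<le> card (strands D p)"
    using st f by (intro card_mono) auto
  then show ?thesis using f assms(4) by (auto simp: crossings_def)
qed

lemma ex_base_point_seq:
  assumes "is_link_diagram D"
  shows "\<exists>a. base_point_seq D a"
proof -
  have "\<exists>p. p \<in> component D i \<and> p \<notin> crossings D" if "i < ncomp D" for i
  proof (rule ccontr)
    assume "\<not> ?thesis"
    then have "component D i \<subseteq> crossings D" by blast
    moreover have "finite (crossings D)" using assms unfolding is_link_diagram_def by blast
    ultimately have fc: "finite (component D i)" by (rule finite_subset)
    have "Pair i ` {0..<1} \<subseteq> (\<Union>p \<in> component D i. strands D p)"
      using that by (auto simp: component_def strands_def)
    moreover have "finite (\<Union>p \<in> component D i. strands D p)"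
      using fc assms by (simp add: is_link_diagram_def)
    ultimately have "finite (Pair i ` {0..<1::real})" by (rule finite_subset)
    then have "finite {0..<1::real}" by (rule finite_imageD) (auto simp: inj_on_def)
    then show False by (simp add: infinite_Ico)
  qed
  then obtain f where f: "\<And>i. i < ncomp D \<Longrightarrow> f i \<in> component D i \<and> f i \<notin> crossings D"
    by metis
  have "base_point_seq D (map f [0..<ncomp D])"
    unfolding base_point_seq_def
  proof (intro conjI allI impI)
    show "\<forall>p\<in>set (map f [0..<ncomp D]). p \<notin> crossings D" using f by simp
    fix i assume i: "i < ncomp D"
    show "\<exists>!k. k < ncomp D \<and> map f [0..<ncomp D] ! k \<in> component D i"
    proof (rule ex1I[of _ i])
      fix k assume k: "k < ncomp D \<and> map f [0..<ncomp D] ! k \<in> component D i"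
      then have "f k \<in> component D i" using nth_map[of k "[0..<ncomp D]" f] by auto
      then show "k = i" using crossing_of_components[OF assms, of k i "f k"] f[of k] i k by blast
    qed (use f i in simp)
  qed simp
  then show ?thesis by blast
qed

text \<open>The minimum in the definition of \<open>ld\<close> is attained.\<close>

lemma ld_attained:
  assumes "is_link_diagram D"
  shows "\<exists>a. base_point_seq D a \<and> ld D = ld_at D a"
proof -
  have "\<exists>n a. base_point_seq D a \<and> n = ld_at D a"
    using ex_base_point_seq[OF assms] by blast
  then show ?thesis unfolding ld_def by (rule LeastI_ex)
qed

end

theory Submission
  imports Defs "HOL-Complex_Analysis.Winding_Numbers"
begin

text \<open>
  Two closed plane curves in general position have intersection number zero
  (\<open>intersection_number_closed_curves_eq_0\<close>): the winding number of one curve around a point that runs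
  along the other one changes by one at each crossing, with a sign that depends on the direction of
  the crossing (\<open>winding_number_jump\<close>), and it returns to its initial value.

  For two components \<open>i\<close> and \<open>j\<close> of a link diagram this says that the crossings at which \<open>i\<close> is the
  under-strand and those at which \<open>j\<close> is the under-strand have equal signed counts. So the linking
  number, which is half of the signed count of all crossings between them, is the signed count of the
  under-crossings of \<open>i\<close> alone (\<open>linking_number_eq_sum_under_crossings\<close>). A sum of \<open>n\<close> signs has absolute
  value at most \<open>n\<close>, with equality if and only if all signs agree, and it has the parity of \<open>n\<close>.
  Therefore, for any order of the components, the number of under-crossings that it counts exceeds the
  sum of the absolute values of the linking numbers by an even natural number, which vanishes if and
  only if the signs agree for each pair of components (\<open>ld_order_eq_linking_plus_even\<close>).

  An order that realizes the minimum \<open>ld D\<close> gives the inequality, the congruence, and one direction of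
  the equality criterion. Conversely, if an order has coherent signs for some orientation, then it
  counts exactly the sum of the absolute linking numbers, which do not depend on the orientation, so
  that \<open>ld D\<close> cannot be larger than this sum.
\<close>

section \<open>Two transverse arcs near their common point\<close>

lemma cross_prod_conv_Im: "cross_prod v w = Im (cnj v * w)"
  by (simp add: cross_prod_def)

lemma abs_cross_prod_le: "\<bar>cross_prod v w\<bar> \<le> norm v * norm w"
  using abs_Im_le_cmod[of "cnj v * w"] by (simp add: cross_prod_conv_Im norm_mult)

lemma cross_prod_self [simp]: "cross_prod v v = 0"
  by (simp add: cross_prod_def)

lemma cross_prod_anticommute: "cross_prod w v = - cross_prod v w"
  by (simp add: cross_prod_def)

lemma cross_prod_linear:
  "cross_prod v (x + y) = cross_prod v x + cross_prod v y"
  "cross_prod v (x - y) = cross_prod v x - cross_prod v y"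
  "cross_prod v (r *\<^sub>R x) = r * cross_prod v x"
  "cross_prod (x + y) v = cross_prod x v + cross_prod y v"
  "cross_prod (x - y) v = cross_prod x v - cross_prod y v"
  "cross_prod (r *\<^sub>R x) v = r * cross_prod x v"
  by (simp_all add: cross_prod_def algebra_simps)

lemma Im_divide_eq_cross_prod: "Im (z / u) = cross_prod u z / (norm u)\<^sup>2"
  by (simp add: Im_divide cross_prod_def cmod_power2 mult.commute)

lemma has_vector_derivative_increment_bound:
  fixes f :: "real \<Rightarrow> complex"
  assumes "(f has_vector_derivative f') (at x)" "0 < \<eta>"
  shows "\<exists>\<epsilon>>0. \<forall>y. \<bar>y - x\<bar> < \<epsilon> \<longrightarrow> norm (f y - f x - (y - x) *\<^sub>R f') \<le> \<eta> * \<bar>y - x\<bar>"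
  using assms unfolding has_vector_derivative_def has_derivative_at_alt by auto

text \<open>
  Up to first order, \<open>b t - a s\<close> is \<open>(t - t\<^sub>0) v - (s - s\<^sub>0) u\<close>. If this difference is a
  multiple \<open>r u\<close> of \<open>u\<close>, then its \<open>v\<close>-coordinate forces \<open>t\<close> to be close to \<open>t\<^sub>0\<close> compared with
  \<open>s - s\<^sub>0\<close>, so that \<open>r\<close> is close to \<open>- (s - s\<^sub>0)\<close>. Hence just after the meeting time the arc \<open>b\<close>, seen
  from \<open>a s\<close>, avoids the whole ray in direction \<open>u\<close>, and just before it avoids the opposite ray.
  At the meeting time itself, the arc \<open>b\<close> passes from one side of the line through \<open>u\<close> to the other
  one, in the direction given by the sign of \<open>cross_prod u v\<close>.
\<close>

lemma transverse_arcs_slit: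
  fixes a b :: "real \<Rightarrow> complex"
  assumes a: "(a has_vector_derivative u) (at s\<^sub>0)" and b: "(b has_vector_derivative v) (at t\<^sub>0)"
    and meet: "a s\<^sub>0 = b t\<^sub>0" and c: "cross_prod u v \<noteq> 0"
  obtains \<epsilon> where "0 < \<epsilon>"
    "\<And>s t r. \<bar>s - s\<^sub>0\<bar> < \<epsilon> \<Longrightarrow> \<bar>t - t\<^sub>0\<bar> < \<epsilon> \<Longrightarrow> s \<noteq> s\<^sub>0 \<Longrightarrow> b t - a s = r *\<^sub>R u \<Longrightarrow> r * (s - s\<^sub>0) < 0"
    "\<And>t. \<bar>t - t\<^sub>0\<bar> < \<epsilon> \<Longrightarrow>
        sgn (Im ((b t - a s\<^sub>0) / u)) = sgn (t - t\<^sub>0) * sgn (cross_prod u v)"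
proof -
  define c where "c = cross_prod u v"
  \<comment> \<open>The relative error \<open>\<eta>\<close> is chosen so that in both coordinates the first-order error costs at most
    a quarter of \<open>\<bar>t - t\<^sub>0\<bar> + \<bar>s - s\<^sub>0\<bar>\<close>.\<close>
  define \<eta> where "\<eta> = \<bar>c\<bar> / (4 * (norm u + norm v + 1))"
  have cpos: "\<bar>c\<bar> > 0" using c by (simp add: c_def)
  have den: "norm u + norm v + 1 > 0" by (simp add: add_nonneg_pos)
  have \<eta>: "\<eta> > 0" using cpos den by (simp add: \<eta>_def)
  have \<eta>u: "norm u * \<eta> \<le> \<bar>c\<bar> / 4" and \<eta>v: "norm v * \<eta> \<le> \<bar>c\<bar> / 4"
  proof -
    have "4 * (norm u + norm v + 1) * \<eta> = \<bar>c\<bar>" using den by (simp add: \<eta>_def)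
    moreover have "0 \<le> norm u * \<eta>" "0 \<le> norm v * \<eta>" using \<eta> by simp_all
    ultimately show "norm u * \<eta> \<le> \<bar>c\<bar> / 4" "norm v * \<eta> \<le> \<bar>c\<bar> / 4"
      using \<eta> by (auto simp only: algebra_simps)
  qed
  have u0: "u \<noteq> 0" using c by (auto simp: cross_prod_def)
  obtain \<epsilon>1 where \<epsilon>1: "\<epsilon>1 > 0"
    "\<And>s. \<bar>s - s\<^sub>0\<bar> < \<epsilon>1 \<Longrightarrow> norm (a s - a s\<^sub>0 - (s - s\<^sub>0) *\<^sub>R u) \<le> \<eta> * \<bar>s - s\<^sub>0\<bar>"
    using has_vector_derivative_increment_bound[OF a \<eta>] by blast
  obtain \<epsilon>2 where \<epsilon>2: "\<epsilon>2 > 0"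
    "\<And>t. \<bar>t - t\<^sub>0\<bar> < \<epsilon>2 \<Longrightarrow> norm (b t - b t\<^sub>0 - (t - t\<^sub>0) *\<^sub>R v) \<le> \<eta> * \<bar>t - t\<^sub>0\<bar>"
    using has_vector_derivative_increment_bound[OF b \<eta>] by blast
  show thesis
  proof (rule that[of "min \<epsilon>1 \<epsilon>2"])
    fix s t r
    assume st: "\<bar>s - s\<^sub>0\<bar> < min \<epsilon>1 \<epsilon>2" "\<bar>t - t\<^sub>0\<bar> < min \<epsilon>1 \<epsilon>2" "s \<noteq> s\<^sub>0" and r: "b t - a s = r *\<^sub>R u"
    define h \<tau> where "h = s - s\<^sub>0" and "\<tau> = t - t\<^sub>0"
    define e where "e = (b t - b t\<^sub>0 - \<tau> *\<^sub>R v) - (a s - a s\<^sub>0 - h *\<^sub>R u)"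
    have "norm e \<le> \<eta> * \<bar>\<tau>\<bar> + \<eta> * \<bar>h\<bar>"
      unfolding e_def h_def \<tau>_def
      by (rule order_trans[OF norm_triangle_ineq4]) (use \<epsilon>1(2)[of s] \<epsilon>2(2)[of t] st in auto)
    then have e: "norm e \<le> \<eta> * (\<bar>\<tau>\<bar> + \<bar>h\<bar>)" by (simp add: algebra_simps)
    have bound: "\<bar>cross_prod x e\<bar> \<le> \<bar>c\<bar> * ((\<bar>\<tau>\<bar> + \<bar>h\<bar>) / 4)" if "norm x * \<eta> \<le> \<bar>c\<bar> / 4" for x
    proof -
      have "\<bar>cross_prod x e\<bar> \<le> norm x * (\<eta> * (\<bar>\<tau>\<bar> + \<bar>h\<bar>))"
        by (rule order_trans[OF abs_cross_prod_le mult_left_mono[OF e]]) simp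
      also have "\<dots> \<le> \<bar>c\<bar> / 4 * (\<bar>\<tau>\<bar> + \<bar>h\<bar>)"
        using mult_right_mono[OF that, of "\<bar>\<tau>\<bar> + \<bar>h\<bar>"] by (simp add: mult.assoc)
      finally show ?thesis by simp
    qed
    have z: "\<tau> *\<^sub>R v - h *\<^sub>R u + e = r *\<^sub>R u"
      using r meet by (simp add: e_def algebra_simps)
    \<comment> \<open>The coordinates of this equation in the basis \<open>u\<close>, \<open>v\<close> are read off with
      \<open>cross_prod u\<close> and \<open>cross_prod v\<close>.\<close>
    have "cross_prod u (\<tau> *\<^sub>R v - h *\<^sub>R u + e) = 0"
      unfolding z by (simp add: cross_prod_linear)
    then have "\<tau> * c = - cross_prod u e" by (simp add: cross_prod_linear c_def)
    then have "\<bar>\<tau>\<bar> * \<bar>c\<bar> = \<bar>cross_prod u e\<bar>" by (metis abs_minus_cancel abs_mult)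
    then have "\<bar>c\<bar> * \<bar>\<tau>\<bar> \<le> \<bar>c\<bar> * ((\<bar>\<tau>\<bar> + \<bar>h\<bar>) / 4)" using bound[OF \<eta>u] by (simp add: mult.commute)
    then have \<tau>: "\<bar>\<tau>\<bar> \<le> (\<bar>\<tau>\<bar> + \<bar>h\<bar>) / 4" using cpos by (simp only: mult_le_cancel_left_pos)
    have "cross_prod v (\<tau> *\<^sub>R v - h *\<^sub>R u + e) = cross_prod v (r *\<^sub>R u)"
      unfolding z ..
    then have "(r + h) * c = - cross_prod v e"
      by (simp add: cross_prod_linear c_def cross_prod_anticommute[of v u] algebra_simps)
    then have "\<bar>r + h\<bar> * \<bar>c\<bar> = \<bar>cross_prod v e\<bar>" by (metis abs_minus_cancel abs_mult)
    then have "\<bar>c\<bar> * \<bar>r + h\<bar> \<le> \<bar>c\<bar> * ((\<bar>\<tau>\<bar> + \<bar>h\<bar>) / 4)" using bound[OF \<eta>v] by (simp add: mult.commute)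
    then have "\<bar>r + h\<bar> \<le> (\<bar>\<tau>\<bar> + \<bar>h\<bar>) / 4" using cpos by (simp only: mult_le_cancel_left_pos)
    moreover have "h \<noteq> 0" using st by (simp add: h_def)
    ultimately have "(r < 0 \<and> h > 0) \<or> (r > 0 \<and> h < 0)" using \<tau> by (cases "h > 0") (simp_all add: abs_if split: if_splits)
    then show "r * (s - s\<^sub>0) < 0" by (auto simp: h_def mult_less_0_iff)
  next
    fix t assume t: "\<bar>t - t\<^sub>0\<bar> < min \<epsilon>1 \<epsilon>2"
    define \<tau> e where "\<tau> = t - t\<^sub>0" and "e = b t - b t\<^sub>0 - \<tau> *\<^sub>R v"
    have "\<bar>cross_prod u e\<bar> \<le> norm u * (\<eta> * \<bar>\<tau>\<bar>)"
      using t by (intro order_trans[OF abs_cross_prod_le mult_left_mono])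
        (auto simp: e_def \<tau>_def intro!: \<epsilon>2(2))
    also have "\<dots> \<le> \<bar>c\<bar> / 4 * \<bar>\<tau>\<bar>"
      using mult_right_mono[OF \<eta>u, of "\<bar>\<tau>\<bar>"] by (simp add: mult.assoc)
    finally have "\<bar>cross_prod u e\<bar> \<le> \<bar>\<tau> * c\<bar> / 4" by (simp add: abs_mult mult.commute)
    then have "sgn (\<tau> * c + cross_prod u e) = sgn (\<tau> * c)"
      by (auto simp: sgn_if)
    moreover have "cross_prod u (b t - a s\<^sub>0) = \<tau> * c + cross_prod u e"
      by (simp add: e_def meet cross_prod_linear c_def)
    ultimately show "sgn (Im ((b t - a s\<^sub>0) / u)) = sgn (t - t\<^sub>0) * sgn (cross_prod u v)"
      using u0 by (simp add: Im_divide_eq_cross_prod sgn_divide sgn_mult \<tau>_def c_def)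
  qed (use \<epsilon>1 \<epsilon>2 in auto)
qed

section \<open>The winding number jumps at a crossing\<close>

text \<open>
  On the plane slit along a ray from \<open>z\<close>, a branch of the logarithm is a primitive of
  \<open>1 / (w - z)\<close>; dividing by \<open>k\<close> turns the ray into the cut of the principal branch.
\<close>

lemma winding_number_arc_off_ray:
  assumes g: "valid_path g" and k: "k \<noteq> 0"
    and ray: "\<And>w. w \<in> path_image g \<Longrightarrow> (w - z) / k \<notin> \<real>\<^sub>\<le>\<^sub>0"
  shows "winding_number g z =
    (Ln ((pathfinish g - z) / k) - Ln ((pathstart g - z) / k)) / (2 * of_real pi * \<i>)"
proof -
  have z: "z \<notin> path_image g" using ray[of z] by auto
  have "((\<lambda>w. 1 / (w - z)) has_contour_integral
      Ln ((pathfinish g - z) / k) - Ln ((pathstart g - z) / k)) g"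
  proof (rule contour_integral_primitive[where S = "path_image g"])
    fix w assume w: "w \<in> path_image g"
    then have "w \<noteq> z" using z by auto
    then show "((\<lambda>w. Ln ((w - z) / k)) has_field_derivative 1 / (w - z)) (at w within path_image g)"
      using ray[OF w] k by (auto intro!: derivative_eq_intros simp: field_simps)
  qed (use g in auto)
  then show ?thesis
    using winding_number_valid_path[OF g z] by (simp add: contour_integral_unique)
qed

lemma periodic_of_int:
  fixes f :: "real \<Rightarrow> 'a"
  assumes "\<And>t. f (t + 1) = f t"
  shows "f (t + of_int n) = f t"
proof (induction n rule: int_induct[where k = 0])
  case (step1 i) then show ?case using assms[of "t + of_int i"] by (simp add: algebra_simps)
next
  case (step2 i) then show ?case using assms[of "t + of_int i - 1"] by (simp add: algebra_simps)
qed simp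

lemma range_periodic:
  fixes f :: "real \<Rightarrow> 'a"
  assumes "\<And>t. f (t + 1) = f t"
  shows "f ` {c..c + 1} = range f"
proof -
  have "f t \<in> f ` {c..c + 1}" for t
  proof (rule image_eqI)
    show "f t = f (t + of_int (- \<lfloor>t - c\<rfloor>))" by (rule periodic_of_int[of f, OF assms, symmetric])
    show "t + of_int (- \<lfloor>t - c\<rfloor>) \<in> {c..c + 1}" by (simp; linarith)
  qed
  then show ?thesis by auto
qed

lemma C1_differentiable_shift:
  assumes "f C1_differentiable_on UNIV"
  shows "(\<lambda>x. f (c + x)) C1_differentiable_on UNIV"
proof -
  obtain D where D: "\<And>x. (f has_vector_derivative D x) (at x)" "continuous_on UNIV D"
    using assms by (auto simp: C1_differentiable_on_def)
  have "((\<lambda>x. f (c + x)) has_vector_derivative D (c + x)) (at x)" for x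
  proof -
    have "((\<lambda>x. c + x) has_vector_derivative 1) (at x)"
      unfolding has_real_derivative_iff_has_vector_derivative[symmetric]
      by (auto intro!: derivative_eq_intros)
    from vector_diff_chain_at[OF this D(1)] show ?thesis by (simp add: o_def)
  qed
  moreover have "continuous_on UNIV (\<lambda>x. D (c + x))"
    by (rule continuous_on_compose2[OF D(2)]) (auto intro!: continuous_intros)
  ultimately show ?thesis
    unfolding C1_differentiable_on_def by (intro exI[of _ "\<lambda>x. D (c + x)"]) auto
qed

lemma C1_imp_valid_path: "f C1_differentiable_on UNIV \<Longrightarrow> valid_path f"
  unfolding valid_path_def
  by (rule C1_differentiable_imp_piecewise) (erule C1_differentiable_on_subset, simp)

lemma winding_number_periodic_shift:
  assumes C1: "b C1_differentiable_on UNIV" and per: "\<And>t. b (t + 1) = b t" and z: "z \<notin> range b"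
  shows "winding_number (\<lambda>x. b (c + x)) z = winding_number b z"
proof -
  have "b (c + x) = shiftpath (frac c) b x" for x
  proof -
    have "b (frac c + x + of_int \<lfloor>c\<rfloor>) = b (frac c + x)" by (rule periodic_of_int[of b, OF per])
    moreover have "b (frac c + x - 1 + 1) = b (frac c + x - 1)" by (rule per)
    ultimately show ?thesis by (simp add: shiftpath_def frac_def algebra_simps)
  qed
  then have "(\<lambda>x. b (c + x)) = shiftpath (frac c) b" by blast
  moreover have "path b" using C1_imp_valid_path[OF C1] by (rule valid_path_imp_path)
  moreover have "b 1 = b 0" using per[of 0] by simp
  ultimately show ?thesis
    using z frac_lt_1[of c]
    by (auto intro!: winding_number_shiftpath simp: path_image_def pathfinish_def pathstart_def less_imp_le)
qed

text \<open>
  Cut \<open>b\<close> into a short arc \<open>g\<close> around the crossing and two outer arcs. The outer arcs stay away from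
  the crossing, so that their contribution is continuous there. By \<open>transverse_arcs_slit\<close> the contribution
  of \<open>g\<close> is a difference of logarithms at its end points, for the branch cut along \<open>- u\<close> before
  the crossing and along \<open>u\<close> after it. The end points of \<open>g\<close> lie on different sides of the line through
  \<open>u\<close>, so this change of branch changes the two logarithms by \<open>\<pi> \<i>\<close> in opposite directions, and the
  winding number by one.
\<close>

lemma winding_number_jump:
  fixes a b :: "real \<Rightarrow> complex"
  assumes C1: "b C1_differentiable_on UNIV" and per: "\<And>t. b (t + 1) = b t"
    and a: "(a has_vector_derivative u) (at s\<^sub>0)" and b: "(b has_vector_derivative v) (at t\<^sub>0)"
    and meet: "a s\<^sub>0 = b t\<^sub>0" and c: "cross_prod u v \<noteq> 0"
    and once: "\<And>t. b t = a s\<^sub>0 \<Longrightarrow> t - t\<^sub>0 \<in> \<int>"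
    and off: "eventually (\<lambda>s. a s \<notin> range b) (at s\<^sub>0)"
  shows "\<exists>K. ((\<lambda>s. winding_number b (a s)) \<longlongrightarrow> K) (at_left s\<^sub>0) \<and>
             ((\<lambda>s. winding_number b (a s)) \<longlongrightarrow> K - of_real (sgn (cross_prod u v))) (at_right s\<^sub>0)"
proof -
  obtain \<epsilon>' where "\<epsilon>' > 0" and slit':
    "\<And>s t r. \<bar>s - s\<^sub>0\<bar> < \<epsilon>' \<Longrightarrow> \<bar>t - t\<^sub>0\<bar> < \<epsilon>' \<Longrightarrow> s \<noteq> s\<^sub>0 \<Longrightarrow> b t - a s = r *\<^sub>R u \<Longrightarrow> r * (s - s\<^sub>0) < 0"
    "\<And>t. \<bar>t - t\<^sub>0\<bar> < \<epsilon>' \<Longrightarrow> sgn (Im ((b t - a s\<^sub>0) / u)) = sgn (t - t\<^sub>0) * sgn (cross_prod u v)"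
    using transverse_arcs_slit[OF a b meet c] by metis
  define \<epsilon> where "\<epsilon> = min (\<epsilon>' / 2) (1 / 4)"
  have \<epsilon>: "0 < \<epsilon>" "\<epsilon> < \<epsilon>'" "\<epsilon> < 1 / 2" using \<open>\<epsilon>' > 0\<close> by (auto simp: \<epsilon>_def min_def)
  have u0: "u \<noteq> 0" using c by (auto simp: cross_prod_def)
  \<comment> \<open>The base point of the loop is moved so that the crossing has the parameter \<open>1/2\<close>.\<close>
  define \<beta> where "\<beta> = (\<lambda>x. b (t\<^sub>0 - 1/2 + x))"
  have v\<beta>: "valid_path \<beta>"
    unfolding \<beta>_def by (intro C1_imp_valid_path C1_differentiable_shift C1)
  have im\<beta>: "path_image \<beta> \<subseteq> range b" by (auto simp: path_image_def \<beta>_def)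
  define g1 g g2 where "g1 = subpath 0 (1/2 - \<epsilon>) \<beta>" and "g = subpath (1/2 - \<epsilon>) (1/2 + \<epsilon>) \<beta>"
    and "g2 = subpath (1/2 + \<epsilon>) 1 \<beta>"
  have vg: "valid_path g1" "valid_path g" "valid_path g2"
    using \<epsilon> v\<beta> by (auto simp: g1_def g_def g2_def intro!: valid_path_subpath)
  have parts: "winding_number b z = winding_number g1 z + winding_number g z + winding_number g2 z"
    if "z \<notin> range b" for z
  proof -
    have z: "z \<notin> path_image \<beta>" using that im\<beta> by auto
    have p: "path \<beta>" using v\<beta> by (rule valid_path_imp_path)
    have "winding_number b z = winding_number \<beta> z"
      unfolding \<beta>_def by (rule winding_number_periodic_shift[OF C1 per that, symmetric])
    also have "\<dots> = winding_number (subpath 0 (1/2 + \<epsilon>) \<beta>) z + winding_number g2 z"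
      using winding_number_subpath_combine[OF p z, of 0 "1/2 + \<epsilon>" 1] \<epsilon> by (simp add: g2_def)
    also have "winding_number (subpath 0 (1/2 + \<epsilon>) \<beta>) z = winding_number g1 z + winding_number g z"
      using winding_number_subpath_combine[OF p z, of 0 "1/2 - \<epsilon>" "1/2 + \<epsilon>"] \<epsilon>
      by (simp add: g1_def g_def)
    finally show ?thesis by simp
  qed
  have \<beta>0: "\<bar>x - 1/2\<bar> < \<epsilon>" if "\<beta> x = a s\<^sub>0" "0 \<le> x" "x \<le> 1" for x
  proof -
    have "x - 1/2 \<in> \<int>" using once[of "t\<^sub>0 - 1/2 + x"] that by (simp add: \<beta>_def)
    then obtain n where n: "x - 1/2 = of_int n" by (auto elim: Ints_cases)
    then have "n = 0" using that by linarith
    then show ?thesis using n \<epsilon> by simp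
  qed
  have z12: "a s\<^sub>0 \<notin> path_image g1" "a s\<^sub>0 \<notin> path_image g2"
    using \<beta>0 \<epsilon> by (force simp: g1_def g2_def path_image_subpath)+
  have conta: "(a \<longlongrightarrow> a s\<^sub>0) (at s\<^sub>0)"
    using has_vector_derivative_continuous[OF a] by (simp add: continuous_within)
  have outer: "((\<lambda>s. winding_number h (a s)) \<longlongrightarrow> winding_number h (a s\<^sub>0)) (at s\<^sub>0)"
    if "valid_path h" "a s\<^sub>0 \<notin> path_image h" for h
    using continuous_at_winding_number[OF valid_path_imp_path[OF that(1)] that(2)] conta
    by (rule isCont_tendsto_compose)
  define q r where "q = b (t\<^sub>0 + \<epsilon>)" and "r = b (t\<^sub>0 - \<epsilon>)"
  define X Y where "X = (q - a s\<^sub>0) / u" and "Y = (r - a s\<^sub>0) / u"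
  have XY: "sgn (Im X) = sgn (cross_prod u v)" "sgn (Im Y) = - sgn (cross_prod u v)"
    using slit'(2)[of "t\<^sub>0 + \<epsilon>"] slit'(2)[of "t\<^sub>0 - \<epsilon>"] \<epsilon> by (simp_all add: X_def Y_def q_def r_def)
  have ends: "pathfinish g = q" "pathstart g = r"
    by (simp_all add: g_def subpath_def pathfinish_def pathstart_def \<beta>_def q_def r_def)
  \<comment> \<open>\<open>M k s\<close> is the contribution of \<open>g\<close> for the branch of the logarithm cut along \<open>- k\<close>.\<close>
  define M where "M = (\<lambda>k s. (Ln ((q - a s) / k) - Ln ((r - a s) / k)) / (2 * of_real pi * \<i>))"
  have imX: "Im X \<noteq> 0" "Im Y \<noteq> 0" using XY c by (auto simp: sgn_if split: if_splits)
  have limM: "(M k \<longlongrightarrow> M k s\<^sub>0) (at s\<^sub>0)" if "k = u \<or> k = - u" for k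
    unfolding M_def using imX that
    by (intro tendsto_intros conta)
       (auto simp: X_def Y_def complex_nonpos_Reals_iff u0)
  have near: "eventually (\<lambda>s. a s \<notin> range b \<and> \<bar>s - s\<^sub>0\<bar> < \<epsilon>') (at s\<^sub>0)"
    using off by (rule eventually_conj)
      (use \<open>\<epsilon>' > 0\<close> in \<open>auto simp: eventually_at dist_real_def\<close>)
  have mid: "winding_number g (a s) = M k s"
    if "\<bar>s - s\<^sub>0\<bar> < \<epsilon>'" "s < s\<^sub>0 \<and> k = u \<or> s\<^sub>0 < s \<and> k = - u" for s k
  proof -
    have "winding_number g (a s) =
        (Ln ((pathfinish g - a s) / k) - Ln ((pathstart g - a s) / k)) / (2 * of_real pi * \<i>)"
    proof (rule winding_number_arc_off_ray[OF vg(2)])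
      show k0: "k \<noteq> 0" using that u0 by auto
      fix w assume "w \<in> path_image g"
      then obtain x where x: "w = b (t\<^sub>0 - 1/2 + x)" "1/2 - \<epsilon> \<le> x" "x \<le> 1/2 + \<epsilon>"
        using \<epsilon> by (auto simp: g_def path_image_subpath \<beta>_def)
      show "(w - a s) / k \<notin> \<real>\<^sub>\<le>\<^sub>0"
      proof
        assume "(w - a s) / k \<in> \<real>\<^sub>\<le>\<^sub>0"
        then obtain \<rho> where \<rho>: "(w - a s) / k = of_real \<rho>" "\<rho> \<le> 0"
          by (auto elim: nonpos_Reals_cases)
        then have wk: "w - a s = of_real \<rho> * k" using k0 by (simp add: field_simps)
        define \<rho>' where "\<rho>' = (if k = u then \<rho> else - \<rho>)"
        have "b (t\<^sub>0 - 1/2 + x) - a s = \<rho>' *\<^sub>R u"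
          using wk that(2) x(1) by (auto simp: scaleR_conv_of_real \<rho>'_def)
        then have "\<rho>' * (s - s\<^sub>0) < 0"
          using slit'(1)[of s "t\<^sub>0 - 1/2 + x" \<rho>'] that x \<epsilon> by (auto simp: abs_if)
        moreover have "u \<noteq> - u" using u0 by simp
        ultimately show False
          using that(2) \<rho>(2) by (auto simp: \<rho>'_def mult_less_0_iff)
      qed
    qed
    then show ?thesis by (simp add: M_def ends)
  qed
  have mid_left: "winding_number g (a s) = M u s" if "\<bar>s - s\<^sub>0\<bar> < \<epsilon>'" "s < s\<^sub>0" for s
    using mid that by blast
  have mid_right: "winding_number g (a s) = M (- u) s" if "\<bar>s - s\<^sub>0\<bar> < \<epsilon>'" "s\<^sub>0 < s" for s
    using mid that by blast
  define K where "K = winding_number g1 (a s\<^sub>0) + M u s\<^sub>0 + winding_number g2 (a s\<^sub>0)"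
  have lim: "((\<lambda>s. winding_number g1 (a s) + M k s + winding_number g2 (a s)) \<longlongrightarrow>
      winding_number g1 (a s\<^sub>0) + M k s\<^sub>0 + winding_number g2 (a s\<^sub>0)) (at s\<^sub>0)" if "k = u \<or> k = - u" for k
    by (intro tendsto_intros outer limM vg z12 that)
  have left: "((\<lambda>s. winding_number b (a s)) \<longlongrightarrow> K) (at_left s\<^sub>0)"
  proof (rule Lim_transform_eventually)
    show "((\<lambda>s. winding_number g1 (a s) + M u s + winding_number g2 (a s)) \<longlongrightarrow> K) (at_left s\<^sub>0)"
      unfolding K_def by (rule tendsto_mono[OF at_le lim]) auto
    show "eventually (\<lambda>s. winding_number g1 (a s) + M u s + winding_number g2 (a s) =
        winding_number b (a s)) (at_left s\<^sub>0)"
      using near unfolding eventually_at_filter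
    proof eventually_elim
      case (elim x)
      show ?case
      proof (intro impI)
        assume "x \<noteq> s\<^sub>0" "x \<in> {..<s\<^sub>0}"
        then have "a x \<notin> range b" "\<bar>x - s\<^sub>0\<bar> < \<epsilon>'" "x < s\<^sub>0" using elim by auto
        with parts[of "a x"] mid_left[of x]
        show "winding_number g1 (a x) + M u x + winding_number g2 (a x) = winding_number b (a x)"
          by metis
      qed
    qed
  qed
  have "M (- u) s\<^sub>0 = M u s\<^sub>0 - of_real (sgn (cross_prod u v))"
  proof -
    have "M (- u) s\<^sub>0 = (Ln (- X) - Ln (- Y)) / (2 * of_real pi * \<i>)"
      by (simp add: M_def X_def Y_def)
    moreover have "M u s\<^sub>0 = (Ln X - Ln Y) / (2 * of_real pi * \<i>)"
      by (simp add: M_def X_def Y_def)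
    moreover have "Ln (- X) - Ln (- Y) =
        Ln X - Ln Y - 2 * of_real pi * \<i> * of_real (sgn (cross_prod u v))"
    proof -
      have nz: "X \<noteq> 0" "Y \<noteq> 0" using imX by auto
      consider "cross_prod u v > 0" | "cross_prod u v < 0" using c by linarith
      then show ?thesis
      proof cases
        case 1
        then have "Im X > 0" "Im Y < 0" using XY by (auto simp: sgn_if split: if_splits)
        then have "Ln (- X) = Ln X - \<i> * pi" "Ln (- Y) = Ln Y + \<i> * pi"
          using Ln_minus[OF nz(1)] Ln_minus[OF nz(2)] by auto
        then show ?thesis using 1 by simp
      next
        case 2
        then have "Im X < 0" "Im Y > 0" using XY by (auto simp: sgn_if split: if_splits)
        then have "Ln (- X) = Ln X + \<i> * pi" "Ln (- Y) = Ln Y - \<i> * pi"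
          using Ln_minus[OF nz(1)] Ln_minus[OF nz(2)] by auto
        then show ?thesis using 2 by simp
      qed
    qed
    ultimately show ?thesis by (simp add: diff_divide_distrib)
  qed
  then have K': "K - of_real (sgn (cross_prod u v)) =
      winding_number g1 (a s\<^sub>0) + M (- u) s\<^sub>0 + winding_number g2 (a s\<^sub>0)"
    by (simp add: K_def)
  have right: "((\<lambda>s. winding_number b (a s)) \<longlongrightarrow> K - of_real (sgn (cross_prod u v))) (at_right s\<^sub>0)"
  proof (rule Lim_transform_eventually)
    show "((\<lambda>s. winding_number g1 (a s) + M (- u) s + winding_number g2 (a s)) \<longlongrightarrow>
        K - of_real (sgn (cross_prod u v))) (at_right s\<^sub>0)"
      unfolding K' by (rule tendsto_mono[OF at_le lim]) auto
    show "eventually (\<lambda>s. winding_number g1 (a s) + M (- u) s + winding_number g2 (a s) =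
        winding_number b (a s)) (at_right s\<^sub>0)"
      using near unfolding eventually_at_filter
    proof eventually_elim
      case (elim x)
      show ?case
      proof (intro impI)
        assume "x \<noteq> s\<^sub>0" "x \<in> {s\<^sub>0<..}"
        then have "a x \<notin> range b" "\<bar>x - s\<^sub>0\<bar> < \<epsilon>'" "s\<^sub>0 < x" using elim by auto
        with parts[of "a x"] mid_right[of x]
        show "winding_number g1 (a x) + M (- u) x + winding_number g2 (a x) = winding_number b (a x)"
          by metis
      qed
    qed
  qed
  show ?thesis using left right by blast
qed

section \<open>Closed plane curves have intersection number zero\<close>

text \<open>
  Points of \<open>P\<close> other than \<open>a s\<close> are avoided by continuity, and \<open>a s\<close> because the velocity there is
  nonzero. This makes the crossing times of two curves isolated.
\<close>

lemma regular_arc_eventually_avoids_finite: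
  fixes a :: "real \<Rightarrow> complex"
  assumes a: "(a has_vector_derivative u) (at s)" and u: "a s \<in> P \<Longrightarrow> u \<noteq> 0" and P: "finite P"
  shows "eventually (\<lambda>x. a x \<notin> P) (at s)"
proof -
  have "(a \<longlongrightarrow> a s) (at s)"
    using has_vector_derivative_continuous[OF a] by (simp add: continuous_within)
  moreover have "open (- (P - {a s}))"
    by (intro open_Compl finite_imp_closed finite_Diff P)
  ultimately have 1: "eventually (\<lambda>x. a x \<in> - (P - {a s})) (at s)"
    by (rule topological_tendstoD) simp
  have 2: "eventually (\<lambda>x. a x \<noteq> a s) (at s)" if "u \<noteq> 0"
  proof -
    have pos: "0 < norm u / 2" using that by simp
    obtain \<epsilon> where \<epsilon>: "\<epsilon> > 0"
      "\<And>x. \<bar>x - s\<bar> < \<epsilon> \<Longrightarrow> norm (a x - a s - (x - s) *\<^sub>R u) \<le> norm u / 2 * \<bar>x - s\<bar>"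
      using has_vector_derivative_increment_bound[OF a pos] by metis
    have "a x \<noteq> a s" if x: "x \<noteq> s" "\<bar>x - s\<bar> < \<epsilon>" for x
    proof
      assume "a x = a s"
      then have "\<bar>x - s\<bar> * norm u \<le> norm u / 2 * \<bar>x - s\<bar>"
        using \<epsilon>(2)[OF x(2)] by simp
      then show False using x(1) \<open>u \<noteq> 0\<close> by (simp add: field_simps)
    qed
    then show ?thesis using \<epsilon>(1) by (auto simp: eventually_at dist_real_def)
  qed
  show ?thesis
  proof (cases "a s \<in> P")
    case True
    with eventually_conj[OF 1 2] u show ?thesis by (auto elim: eventually_mono)
  next
    case False
    with 1 show ?thesis by simp
  qed
qed

lemma eventually_eq_limit_of_Ints:
  fixes f :: "'a \<Rightarrow> complex"
  assumes f: "(f \<longlongrightarrow> l) F" and Z: "eventually (\<lambda>x. f x \<in> \<int>) F" and F: "F \<noteq> bot"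
  shows "eventually (\<lambda>x. f x = l) F"
proof -
  have l: "l \<in> \<int>" by (rule Lim_in_closed_set[OF closed_Ints Z F f])
  have "eventually (\<lambda>x. dist (f x) l < 1) F" by (rule tendstoD[OF f]) simp
  with Z show ?thesis
  proof eventually_elim
    case (elim x)
    then have "f x - l \<in> \<int>" "norm (f x - l) < 1" using l by (auto simp: dist_norm)
    then show ?case by (auto elim!: Ints_cases simp: norm_of_int simp flip: of_int_abs)
  qed
qed

text \<open>
  \<open>L\<close> stands for the left limits of a step function with jumps \<open>J\<close>. Subtracting the jumps that occur
  before a given time leaves a function that is locally constant on the interval, hence constant.
\<close>

lemma sum_jumps_eq_increment:
  fixes L J :: "real \<Rightarrow> 'a::ab_group_add"
  assumes S: "finite S" "S \<subseteq> {0..<1}" and J: "\<And>s. s \<in> {0..<1} \<Longrightarrow> s \<notin> S \<Longrightarrow> J s = 0"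
    and left: "\<And>s. eventually (\<lambda>x. L x = L s) (at_left s)"
    and right: "\<And>s. eventually (\<lambda>x. L x = L s + J s) (at_right s)"
  shows "sum J S = L 1 - L 0"
proof -
  define G where "G s = L s - sum J {x \<in> S. x < s}" for s
  have "eventually (\<lambda>y. G s = G y) (at s within {0..1})" if s: "s \<in> {0..1}" for s
  proof -
    have "open (- (S - {s}))" by (intro open_Compl finite_imp_closed finite_Diff S)
    then have "eventually (\<lambda>x. x \<in> - (S - {s})) (nhds s)"
      by (rule eventually_nhds_in_open) simp
    then obtain e where e: "e > 0" "\<And>x. \<bar>x - s\<bar> < e \<Longrightarrow> x \<notin> S - {s}"
      by (auto simp: eventually_nhds_metric dist_real_def)
    have apart: "x = s \<or> e \<le> \<bar>x - s\<bar>" if "x \<in> S" for x using e(2)[of x] that by force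
    have near_left: "eventually (\<lambda>x. s - e < x \<and> x < s) (at_left s)"
      using eventually_at_left_real[of "s - e" s] e(1) by auto
    have near_right: "eventually (\<lambda>x. s < x \<and> x < s + e) (at_right s)"
      using eventually_at_right_real[of s "s + e"] e(1) by auto
    have "eventually (\<lambda>y. y \<in> {0..1} \<longrightarrow> G s = G y) (at_left s)"
      using near_left left[of s]
    proof eventually_elim
      case (elim y)
      have "{x \<in> S. x < y} = {x \<in> S. x < s}"
        using elim by (auto dest: apart)
      then show ?case using elim by (simp add: G_def)
    qed
    moreover have "eventually (\<lambda>y. y \<in> {0..1} \<longrightarrow> G s = G y) (at_right s)"
      using near_right right[of s]
    proof eventually_elim
      case (elim y)
      show ?case
      proof
        assume y: "y \<in> {0..1}"
        then have s1: "s \<in> {0..<1}" using s elim by auto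
        have *: "{x \<in> S. x < y} = {x \<in> S. x < s} \<union> ({s} \<inter> S)"
          using elim by (auto dest: apart)
        have "sum J {x \<in> S. x < y} = sum J {x \<in> S. x < s} + sum J ({s} \<inter> S)"
          unfolding * using S by (intro sum.union_disjoint) auto
        also have "sum J ({s} \<inter> S) = J s" using J[OF s1] by (cases "s \<in> S") auto
        finally show "G s = G y" using elim by (simp add: G_def)
      qed
    qed
    ultimately have "eventually (\<lambda>y. y \<in> {0..1} \<longrightarrow> G s = G y) (at s)"
      by (simp add: eventually_at_split)
    then show ?thesis by (auto simp: eventually_at)
  qed
  then have "G 0 = G 1" by (intro connected_local_const[of "{0..1}"]) auto
  moreover have "{x \<in> S. x < 0} = {}" "{x \<in> S. x < 1} = S" using S by auto
  ultimately show ?thesis by (simp add: G_def algebra_simps)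
qed

text \<open>
  The winding number of \<open>b\<close> around \<open>a s\<close> is an integer off the crossing times, so it is a step function
  of \<open>s\<close>. It jumps by minus the intersection sign at each crossing and returns to its initial value
  after one period.
\<close>

theorem intersection_number_closed_curves_eq_0:
  fixes a b :: "real \<Rightarrow> complex" and \<epsilon> :: "complex \<Rightarrow> real"
  assumes a: "a C1_differentiable_on UNIV" "\<And>t. a (t + 1) = a t"
    and b: "b C1_differentiable_on UNIV" "\<And>t. b (t + 1) = b t"
    and fin: "finite (range a \<inter> range b)"
    and transverse: "\<And>s t. a s = b t \<Longrightarrow>
        cross_prod (vector_derivative a (at s)) (vector_derivative b (at t)) \<noteq> 0"
    and once_a: "\<And>s s'. a s = a s' \<Longrightarrow> a s \<in> range b \<Longrightarrow> s - s' \<in> \<int>"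
    and once_b: "\<And>t t'. b t = b t' \<Longrightarrow> b t \<in> range a \<Longrightarrow> t - t' \<in> \<int>"
    and \<epsilon>: "\<And>s t. a s = b t \<Longrightarrow>
        \<epsilon> (a s) = sgn (cross_prod (vector_derivative a (at s)) (vector_derivative b (at t)))"
  shows "(\<Sum>p \<in> range a \<inter> range b. \<epsilon> p) = 0"
proof -
  define P where "P = range a \<inter> range b"
  define a' b' where "a' s = vector_derivative a (at s)" and "b' t = vector_derivative b (at t)" for s t
  have da: "(a has_vector_derivative a' s) (at s)" for s
    using a(1) by (auto simp: C1_differentiable_on_eq a'_def vector_derivative_works)
  have db: "(b has_vector_derivative b' t) (at t)" for t
    using b(1) by (auto simp: C1_differentiable_on_eq b'_def vector_derivative_works)
  have vb: "valid_path b" using b(1) by (rule C1_imp_valid_path)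
  have imb: "path_image b = range b"
    using range_periodic[of b 0, OF b(2)] by (simp add: path_image_def)
  define W where "W s = winding_number b (a s)" for s
  define J where "J s = (if a s \<in> P then - complex_of_real (\<epsilon> (a s)) else 0)" for s
  have finP: "finite P" unfolding P_def by (rule fin)
  have off: "eventually (\<lambda>x. a x \<notin> range b) (at s)" for s
  proof -
    have "a' s \<noteq> 0" if p: "a s \<in> P"
    proof -
      obtain t where "a s = b t" using p by (auto simp: P_def)
      from transverse[OF this] show ?thesis by (auto simp: a'_def cross_prod_def)
    qed
    then have "eventually (\<lambda>x. a x \<notin> P) (at s)"
      using regular_arc_eventually_avoids_finite[OF da _ finP] by blast
    then show ?thesis by (simp add: P_def)
  qed
  have closed: "pathfinish b = pathstart b"
    using b(2)[of 0] by (simp add: pathfinish_def pathstart_def)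
  have W_int: "eventually (\<lambda>x. W x \<in> \<int>) (at s within A)" for s A
    using filter_leD[OF at_le off[of s], of A]
    by (auto simp: W_def imb intro: integer_winding_number[OF valid_path_imp_path[OF vb] closed]
        elim!: eventually_mono)
  \<comment> \<open>At a crossing time this is \<open>winding_number_jump\<close>; elsewhere the winding number is continuous and
    \<open>J s = 0\<close>.\<close>
  have limits: "\<exists>K. (W \<longlongrightarrow> K) (at_left s) \<and> (W \<longlongrightarrow> K + J s) (at_right s)" for s
  proof (cases "a s \<in> P")
    case True
    then obtain t where t: "a s = b t" by (auto simp: P_def)
    have "t' - t \<in> \<int>" if "b t' = a s" for t'
      using once_b[of t' t] that t by (metis rangeI)
    then obtain K where "((\<lambda>s. winding_number b (a s)) \<longlongrightarrow> K) (at_left s)"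
      "((\<lambda>s. winding_number b (a s)) \<longlongrightarrow> K - of_real (sgn (cross_prod (a' s) (b' t)))) (at_right s)"
      using winding_number_jump[OF b da db t _ _ off] transverse[OF t] unfolding a'_def b'_def by metis
    then show ?thesis using True \<epsilon>[OF t]
      by (auto simp: W_def[abs_def] J_def a'_def b'_def)
  next
    case False
    then have "a s \<notin> path_image b" by (auto simp: imb P_def)
    moreover have "(a \<longlongrightarrow> a s) (at s)"
      using has_vector_derivative_continuous[OF da] by (simp add: continuous_within)
    ultimately have "(W \<longlongrightarrow> W s) (at s)" unfolding W_def
      using continuous_at_winding_number[OF valid_path_imp_path[OF vb]] by (metis isCont_tendsto_compose)
    then have "(W \<longlongrightarrow> W s) (at_left s)" "(W \<longlongrightarrow> W s) (at_right s)"
      by (auto intro: tendsto_mono[OF at_le])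
    then show ?thesis using False by (auto simp: J_def)
  qed
  \<comment> \<open>The left limits \<open>L\<close> are meaningful at the crossing times too. The time \<open>0\<close>, where the period is cut
    open, can be such a time.\<close>
  then have "\<exists>L. \<forall>s. (W \<longlongrightarrow> L s) (at_left s) \<and> (W \<longlongrightarrow> L s + J s) (at_right s)"
    by metis
  then obtain L where L: "\<And>s. (W \<longlongrightarrow> L s) (at_left s)" "\<And>s. (W \<longlongrightarrow> L s + J s) (at_right s)"
    by blast
  have WL: "eventually (\<lambda>x. W x = L s) (at_left s)" for s
    by (rule eventually_eq_limit_of_Ints[OF L(1) W_int]) simp
  have WR: "eventually (\<lambda>x. W x = L s + J s) (at_right s)" for s
    by (rule eventually_eq_limit_of_Ints[OF L(2) W_int]) simp
  have L_unique: "L x = k" if "eventually (\<lambda>y. W y = k) (at_left x)" for x k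
    using eventually_happens'[OF _ eventually_conj[OF that WL[of x]]] by auto
  define S where "S = {s \<in> {0..<1}. a s \<in> P}"
  have inj: "inj_on a S"
  proof (rule inj_onI)
    fix s s' assume *: "s \<in> S" "s' \<in> S" "a s = a s'"
    then have "s - s' \<in> \<int>" by (intro once_a) (auto simp: S_def P_def)
    then obtain n where n: "s - s' = of_int n" by (auto elim: Ints_cases)
    then have "n = 0" using * by (auto simp: S_def)
    then show "s = s'" using n by simp
  qed
  have img: "a ` S = P"
  proof -
    have "p \<in> a ` S" if p: "p \<in> P" for p
    proof -
      obtain s where s: "p = a s" using p by (auto simp: P_def)
      have "a (frac s + of_int \<lfloor>s\<rfloor>) = a (frac s)" by (rule periodic_of_int[of a, OF a(2)])
      then have "p = a (frac s)" by (simp add: s frac_def)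
      then show ?thesis using p by (auto simp: S_def frac_lt_1)
    qed
    then show ?thesis by (auto simp: S_def)
  qed
  have "sum J S = L 1 - L 0"
  proof (rule sum_jumps_eq_increment)
    show "finite S" using finite_imageD[OF _ inj] img fin by (simp add: P_def)
    fix s
    have "eventually (\<lambda>x. eventually (\<lambda>y. W y = L s) (at_left x)) (at_left s)"
    proof -
      obtain c where c: "c < s" "\<And>y. c < y \<Longrightarrow> y < s \<Longrightarrow> W y = L s"
        using WL[of s] by (auto simp: eventually_at_left_field)
      have "eventually (\<lambda>y. W y = L s) (at_left x)" if "c < x \<and> x < s" for x
        using that c(2) unfolding eventually_at_left_field by (intro exI[of _ c]) auto
      then show ?thesis using c(1) unfolding eventually_at_left_field by blast
    qed
    then show "eventually (\<lambda>x. L x = L s) (at_left s)"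
      by (rule eventually_mono) (rule L_unique)
    have "eventually (\<lambda>x. eventually (\<lambda>y. W y = L s + J s) (at_left x)) (at_right s)"
    proof -
      obtain c where c: "s < c" "\<And>y. s < y \<Longrightarrow> y < c \<Longrightarrow> W y = L s + J s"
        using WR[of s] by (auto simp: eventually_at_right_field)
      have "eventually (\<lambda>y. W y = L s + J s) (at_left x)" if "s < x \<and> x < c" for x
        using that c(2) unfolding eventually_at_left_field by (intro exI[of _ s]) auto
      then show ?thesis using c(1) unfolding eventually_at_right_field by blast
    qed
    then show "eventually (\<lambda>x. L x = L s + J s) (at_right s)"
      by (rule eventually_mono) (rule L_unique)
  qed (auto simp: S_def J_def)
  also have "L 1 = L 0"
  proof (rule L_unique)
    have "eventually (\<lambda>y. W y = L 0) (at_left (0::real))" by (rule WL)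
    then obtain c where c: "c < 0" "\<And>y. c < y \<Longrightarrow> y < 0 \<Longrightarrow> W y = L 0"
      by (auto simp: eventually_at_left_field)
    have "W y = L 0" if "c + 1 < y" "y < 1" for y
      using c(2)[of "y - 1"] that a(2)[of "y - 1"] by (simp add: W_def)
    then show "eventually (\<lambda>y. W y = L 0) (at_left 1)"
      unfolding eventually_at_left_field using c(1) by (intro exI[of _ "c + 1"]) auto
  qed
  finally have "sum J S = 0" by simp
  moreover have "sum J S = - complex_of_real (\<Sum>p\<in>P. \<epsilon> p)"
  proof -
    have "sum J S = (\<Sum>s\<in>S. - complex_of_real (\<epsilon> (a s)))"
      by (rule sum.cong) (auto simp: J_def S_def)
    also have "\<dots> = - complex_of_real (\<Sum>p\<in>a ` S. \<epsilon> p)"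
      by (simp add: sum.reindex[OF inj] sum_negf)
    finally show ?thesis by (simp only: img)
  qed
  ultimately have "complex_of_real (\<Sum>p\<in>P. \<epsilon> p) = 0" by simp
  then show ?thesis by (simp only: of_real_eq_0_iff P_def)
qed

section \<open>Crossings of two components\<close>

lemma link_diagram_curve:
  assumes "is_link_diagram D" "i < ncomp D"
  shows "curve D i C1_differentiable_on UNIV" "\<And>t. curve D i (t + 1) = curve D i t"
  using assms unfolding is_link_diagram_def by blast+

lemma link_diagram_crossings:
  assumes "is_link_diagram D"
  shows "finite (strands D p)" "card (strands D p) \<le> 2" "finite (crossings D)"
    "\<And>x y. x \<in> strands D p \<Longrightarrow> y \<in> strands D p \<Longrightarrow> x \<noteq> y \<Longrightarrow>
      cross_prod (velocity D x) (velocity D y) \<noteq> 0"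
    "p \<in> crossings D \<Longrightarrow> over D p \<in> strands D p"
  using assms unfolding is_link_diagram_def by blast+

lemma velocity_periodic:
  assumes "is_link_diagram D" "i < ncomp D"
  shows "velocity D (i, t + of_int n) = velocity D (i, t)"
proof -
  let ?f = "curve D i"
  note curve = link_diagram_curve[OF assms]
  have "(?f has_vector_derivative vector_derivative ?f (at (t + of_int n))) (at (t + of_int n))"
    using curve(1) by (auto simp: C1_differentiable_on_eq vector_derivative_works)
  moreover have "((\<lambda>x. x + of_int n) has_vector_derivative 1) (at t)"
    unfolding has_real_derivative_iff_has_vector_derivative[symmetric]
    by (auto intro!: derivative_eq_intros)
  ultimately have "(?f \<circ> (\<lambda>x. x + of_int n) has_vector_derivative
      1 *\<^sub>R vector_derivative ?f (at (t + of_int n))) (at t)"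
    by (intro vector_diff_chain_at)
  moreover have "?f \<circ> (\<lambda>x. x + of_int n) = ?f"
    by (rule ext) (simp add: periodic_of_int[of ?f, OF curve(2)])
  ultimately have "(?f has_vector_derivative vector_derivative ?f (at (t + of_int n))) (at t)"
    by simp
  then show ?thesis by (simp add: velocity_def vector_derivative_at)
qed

lemma frac_strand:
  assumes "is_link_diagram D" "i < ncomp D"
  shows "(i, frac s) \<in> strands D (curve D i s)" "velocity D (i, frac s) = velocity D (i, s)"
proof -
  have "curve D i (frac s + of_int \<lfloor>s\<rfloor>) = curve D i (frac s)"
    by (rule periodic_of_int[of "curve D i"]) (rule link_diagram_curve[OF assms])
  then show "(i, frac s) \<in> strands D (curve D i s)"
    using assms(2) frac_lt_1[of s] by (simp add: strands_def) (simp add: frac_def)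
  show "velocity D (i, frac s) = velocity D (i, s)"
    using velocity_periodic[OF assms, of "frac s" "\<lfloor>s\<rfloor>"] by (simp add: frac_def)
qed

lemma under_eqI:
  assumes "strands D p = {x, y}" "x \<noteq> y" "over D p = x"
  shows "under D p = y"
  unfolding under_def by (rule the_equality) (use assms in auto)

lemma strands_mixed_crossing:
  assumes D: "is_link_diagram D" and ij: "i < ncomp D" "j < ncomp D" "i \<noteq> j"
    and st: "(i, s) \<in> strands D p" "(j, t) \<in> strands D p"
  shows "strands D p = {(i, s), (j, t)}"
    and "over D p = (i, s) \<and> under D p = (j, t) \<or> over D p = (j, t) \<and> under D p = (i, s)"
proof -
  have card: "card {(i, s), (j, t)} = 2" using ij(3) by simp
  show eq: "strands D p = {(i, s), (j, t)}"
    using link_diagram_crossings(1,2)[OF D, of p] st card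
    by (intro card_seteq[symmetric]) auto
  have "over D p \<in> strands D p"
    using link_diagram_crossings(5)[OF D, of p] card eq by (simp add: crossings_def)
  then consider "over D p = (i, s)" | "over D p = (j, t)" using eq by auto
  then show "over D p = (i, s) \<and> under D p = (j, t) \<or> over D p = (j, t) \<and> under D p = (i, s)"
  proof cases
    case 1
    then show ?thesis using under_eqI[OF eq] ij(3) by auto
  next
    case 2
    have "strands D p = {(j, t), (i, s)}" using eq by auto
    from under_eqI[OF this _ 2] show ?thesis using 2 ij(3) by auto
  qed
qed

lemma orientation_values:
  assumes "is_orientation D \<omega>" "i < ncomp D"
  shows "\<omega> i = 1 \<or> \<omega> i = - 1"
  using assms by (auto simp: is_orientation_def)

lemma crossing_sign_mixed:
  assumes D: "is_link_diagram D" and \<omega>: "is_orientation D \<omega>"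
    and ij: "i < ncomp D" "j < ncomp D" "i \<noteq> j"
    and st: "(i, s) \<in> strands D p" "(j, t) \<in> strands D p"
  shows "crossing_sign D \<omega> p = (if fst (under D p) = j then 1 else - 1) * (\<omega> i * \<omega> j) *
    sgn (cross_prod (velocity D (i, s)) (velocity D (j, t)))"
  using strands_mixed_crossing(2)[OF D ij st] ij(3)
    orientation_values[OF \<omega> ij(1)] orientation_values[OF \<omega> ij(2)]
    cross_prod_anticommute[of "velocity D (j, t)" "velocity D (i, s)"]
  by (auto simp: crossing_sign_def direction_def cross_prod_linear sgn_mult sgn_minus)

lemma mixed_crossing_strands:
  assumes "is_link_diagram D" "i < ncomp D" "j < ncomp D" "p \<in> component D i \<inter> component D j"
  obtains s t where "(i, s) \<in> strands D p" "(j, t) \<in> strands D p"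
  using assms component_strand by (metis IntE)

lemma crossing_sign_values:
  assumes D: "is_link_diagram D" and \<omega>: "is_orientation D \<omega>"
    and ij: "i < ncomp D" "j < ncomp D" "i \<noteq> j" and p: "p \<in> component D i \<inter> component D j"
  shows "crossing_sign D \<omega> p = 1 \<or> crossing_sign D \<omega> p = - 1"
proof -
  obtain s t where st: "(i, s) \<in> strands D p" "(j, t) \<in> strands D p"
    using mixed_crossing_strands[OF D ij(1,2) p] by blast
  have "cross_prod (velocity D (i, s)) (velocity D (j, t)) \<noteq> 0"
    using link_diagram_crossings(4)[OF D st] ij(3) by simp
  then show ?thesis
    using crossing_sign_mixed[OF D \<omega> ij st] orientation_values[OF \<omega> ij(1)] orientation_values[OF \<omega> ij(2)]
    by (auto simp: sgn_if)
qed

lemma crossing_sign_reorient: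
  assumes D: "is_link_diagram D" and \<omega>: "is_orientation D \<omega>" and \<omega>': "is_orientation D \<omega>'"
    and ij: "i < ncomp D" "j < ncomp D" "i \<noteq> j" and p: "p \<in> component D i \<inter> component D j"
  shows "crossing_sign D \<omega>' p = \<omega> i * \<omega> j * \<omega>' i * \<omega>' j * crossing_sign D \<omega> p"
proof -
  obtain s t where st: "(i, s) \<in> strands D p" "(j, t) \<in> strands D p"
    using mixed_crossing_strands[OF D ij(1,2) p] by blast
  show ?thesis
    using orientation_values[OF \<omega> ij(1)] orientation_values[OF \<omega> ij(2)]
    unfolding crossing_sign_mixed[OF D \<omega> ij st] crossing_sign_mixed[OF D \<omega>' ij st] by auto
qed

lemma finite_mixed_crossings:
  assumes D: "is_link_diagram D" and ij: "i < ncomp D" "j < ncomp D" "i \<noteq> j"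
  shows "finite (component D i \<inter> component D j)"
  by (rule finite_subset[OF _ link_diagram_crossings(3)[OF D]])
     (use crossing_of_components[OF D ij] in auto)

lemma abs_linking_number_reorient:
  assumes D: "is_link_diagram D" and \<omega>: "is_orientation D \<omega>" and \<omega>': "is_orientation D \<omega>'"
    and ij: "i < ncomp D" "j < ncomp D" "i \<noteq> j"
  shows "\<bar>linking_number D \<omega>' i j\<bar> = \<bar>linking_number D \<omega> i j\<bar>"
proof -
  let ?c = "\<omega> i * \<omega> j * \<omega>' i * \<omega>' j"
  have "(\<Sum>p \<in> component D i \<inter> component D j. crossing_sign D \<omega>' p) =
      ?c * (\<Sum>p \<in> component D i \<inter> component D j. crossing_sign D \<omega> p)"
    unfolding sum_distrib_left
    by (rule sum.cong) (use crossing_sign_reorient[OF D \<omega> \<omega>' ij] in auto)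
  moreover have "\<bar>?c\<bar> = 1"
    using orientation_values[OF \<omega> ij(1)] orientation_values[OF \<omega> ij(2)]
      orientation_values[OF \<omega>' ij(1)] orientation_values[OF \<omega>' ij(2)]
    by (auto simp: abs_mult)
  ultimately show ?thesis by (simp add: linking_number_def abs_mult)
qed

text \<open>
  Exchanging the over-strand and the under-strand reverses the order of the two velocities, hence the
  sign of their cross product. So the sign of a crossing, corrected by which component is under, no
  longer depends on the crossing information: up to the factor \<open>\<omega> i * \<omega> j\<close> it is the intersection
  sign of the two plane curves.
\<close>

lemma signed_over_under_balance:
  assumes D: "is_link_diagram D" and \<omega>: "is_orientation D \<omega>"
    and ij: "i < ncomp D" "j < ncomp D" "i \<noteq> j"
  shows "(\<Sum>p \<in> component D i \<inter> component D j.
    (if fst (under D p) = j then 1 else - 1) * crossing_sign D \<omega> p) = 0"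
proof -
  define \<epsilon> where "\<epsilon> p = \<omega> i * \<omega> j * ((if fst (under D p) = j then 1 else - 1) * crossing_sign D \<omega> p)" for p
  have w: "\<omega> i = 1 \<or> \<omega> i = - 1" "\<omega> j = 1 \<or> \<omega> j = - 1"
    using orientation_values[OF \<omega>] ij by auto
  note fi = frac_strand[OF D ij(1)] and fj = frac_strand[OF D ij(2)]
  have vel: "velocity D (k, t) = vector_derivative (curve D k) (at t)" for k t
    by (simp add: velocity_def)
  \<comment> \<open>A third parameter in \<open>[0, 1)\<close> at a mixed crossing would make it a triple point.\<close>
  have once: "s - s' \<in> \<int>"
    if kl: "k < ncomp D" "l < ncomp D" "k \<noteq> l"
      and s: "curve D k s = curve D k s'" "curve D k s \<in> range (curve D l)"
    for k l s s'
  proof -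
    obtain t where t: "curve D k s = curve D l t" using s(2) by auto
    have "(k, frac s) \<in> strands D (curve D k s)" "(k, frac s') \<in> strands D (curve D k s)"
      "(l, frac t) \<in> strands D (curve D k s)"
      using frac_strand(1)[OF D kl(1), of s] frac_strand(1)[OF D kl(1), of s']
        frac_strand(1)[OF D kl(2), of t] s(1) t by simp_all
    then have "frac s' = frac s"
      using strands_mixed_crossing(1)[OF D kl, of "frac s" "curve D k s" "frac t"] kl(3) by auto
    then have "s - s' = of_int (\<lfloor>s\<rfloor> - \<lfloor>s'\<rfloor>)" by (simp add: frac_def)
    then show ?thesis by (metis Ints_of_int)
  qed
  have "(\<Sum>p \<in> range (curve D i) \<inter> range (curve D j). \<epsilon> p) = 0"
  proof (rule intersection_number_closed_curves_eq_0)
    show "finite (range (curve D i) \<inter> range (curve D j))"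
      using finite_mixed_crossings[OF D ij] by (simp add: component_def)
  next
    fix s t assume eq: "curve D i s = curve D j t"
    have st: "(i, frac s) \<in> strands D (curve D i s)" "(j, frac t) \<in> strands D (curve D i s)"
      using fi(1)[of s] fj(1)[of t] eq by simp_all
    show "cross_prod (vector_derivative (curve D i) (at s)) (vector_derivative (curve D j) (at t)) \<noteq> 0"
      using link_diagram_crossings(4)[OF D st] ij(3) by (simp add: fi(2) fj(2) flip: vel)
    show "\<epsilon> (curve D i s) = sgn (cross_prod (vector_derivative (curve D i) (at s))
        (vector_derivative (curve D j) (at t)))"
      using crossing_sign_mixed[OF D \<omega> ij st] w by (auto simp: \<epsilon>_def fi(2) fj(2) simp flip: vel)
  next
    fix s s' assume "curve D i s = curve D i s'" "curve D i s \<in> range (curve D j)"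
    then show "s - s' \<in> \<int>" using once[of i j] ij by blast
  next
    fix s s' assume "curve D j s = curve D j s'" "curve D j s \<in> range (curve D i)"
    then show "s - s' \<in> \<int>" using once[of j i] ij by blast
  qed (use link_diagram_curve[OF D] ij in auto)
  then show ?thesis using w unfolding \<epsilon>_def component_def by (auto simp flip: sum_distrib_left)
qed

text \<open>
  The crossings with \<open>i\<close> under and those with \<open>j\<close> under have the same signed count, so that each of them
  accounts for half of the sum in the definition of the linking number.
\<close>

lemma linking_number_eq_sum_under_crossings:
  assumes D: "is_link_diagram D" and \<omega>: "is_orientation D \<omega>"
    and ij: "i < ncomp D" "j < ncomp D" "i \<noteq> j"
  shows "linking_number D \<omega> i j = (\<Sum>p \<in> under_crossings D i j. crossing_sign D \<omega> p)"
proof -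
  let ?P = "component D i \<inter> component D j" and ?\<epsilon> = "crossing_sign D \<omega>"
  let ?d = "\<lambda>p. if fst (under D p) = j then 1 else - 1 :: real"
  have fin: "finite ?P" by (rule finite_mixed_crossings[OF D ij])
  have under: "fst (under D p) = i \<or> fst (under D p) = j" if p: "p \<in> ?P" for p
  proof -
    obtain s t where st: "(i, s) \<in> strands D p" "(j, t) \<in> strands D p"
      using mixed_crossing_strands[OF D ij(1,2) p] by blast
    show ?thesis using strands_mixed_crossing(2)[OF D ij st] by auto
  qed
  have "(\<Sum>p\<in>?P. ?\<epsilon> p) = (\<Sum>p\<in>?P. ?\<epsilon> p - ?d p * ?\<epsilon> p)"
    using signed_over_under_balance[OF D \<omega> ij] by (simp add: sum_subtractf)
  also have "\<dots> = (\<Sum>p\<in>?P. if p \<in> under_crossings D i j then 2 * ?\<epsilon> p else 0)"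
  proof (rule sum.cong[OF refl])
    fix p assume p: "p \<in> ?P"
    then have "p \<in> under_crossings D i j \<longleftrightarrow> fst (under D p) \<noteq> j"
      using under[OF p] ij(3) by (auto simp: under_crossings_def)
    then show "?\<epsilon> p - ?d p * ?\<epsilon> p = (if p \<in> under_crossings D i j then 2 * ?\<epsilon> p else 0)"
      by simp
  qed
  also have "\<dots> = (\<Sum>p\<in>?P \<inter> under_crossings D i j. 2 * ?\<epsilon> p)"
    using fin by (simp add: sum.If_cases)
  also have "?P \<inter> under_crossings D i j = under_crossings D i j"
    by (auto simp: under_crossings_def)
  finally show ?thesis by (simp add: linking_number_def flip: sum_distrib_left)
qed

lemma linking_number_commute: "linking_number D \<omega> j i = linking_number D \<omega> i j"
  by (simp add: linking_number_def Int_commute)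

text \<open>
  With \<open>x\<close> positive and \<open>y\<close> negative terms, \<open>m\<close> is the minimum of \<open>x\<close> and \<open>y\<close>.
\<close>

lemma card_eq_abs_sum_signs:
  fixes f :: "'a \<Rightarrow> real"
  assumes U: "finite U" and f: "\<And>p. p \<in> U \<Longrightarrow> f p = 1 \<or> f p = - 1"
  shows "\<exists>m::nat. real (card U) = \<bar>sum f U\<bar> + 2 * real m \<and>
    (m = 0 \<longleftrightarrow> (\<forall>p\<in>U. f p = 1) \<or> (\<forall>p\<in>U. f p = - 1))"
proof -
  define A B where "A = {p \<in> U. f p = 1}" and "B = {p \<in> U. f p = - 1}"
  have AB: "U = A \<union> B" "A \<inter> B = {}" "finite A" "finite B" using U f by (auto simp: A_def B_def)
  have card: "card U = card A + card B"
    unfolding AB(1) by (rule card_Un_disjoint[OF AB(3,4,2)])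
  have "sum f U = sum f A + sum f B"
    unfolding AB(1) by (rule sum.union_disjoint[OF AB(3,4,2)])
  also have "sum f A = (\<Sum>p\<in>A. 1)" by (rule sum.cong) (auto simp: A_def)
  also have "sum f B = (\<Sum>p\<in>B. - 1)" by (rule sum.cong) (auto simp: B_def)
  finally have sum: "sum f U = real (card A) - real (card B)" by simp
  have A_empty: "A = {} \<longleftrightarrow> (\<forall>p\<in>U. f p = - 1)"
  proof
    assume "A = {}"
    then show "\<forall>p\<in>U. f p = - 1" using f unfolding A_def by blast
  next
    assume "\<forall>p\<in>U. f p = - 1"
    then show "A = {}" by (auto simp: A_def)
  qed
  have B_empty: "B = {} \<longleftrightarrow> (\<forall>p\<in>U. f p = 1)"
  proof
    assume "B = {}"
    then show "\<forall>p\<in>U. f p = 1" using f unfolding B_def by blast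
  next
    assume "\<forall>p\<in>U. f p = 1"
    then show "B = {}" by (auto simp: B_def)
  qed
  show ?thesis
  proof (intro exI conjI)
    have "\<bar>real (card A) - real (card B)\<bar> + 2 * min (real (card A)) (real (card B)) =
        real (card A) + real (card B)" by linarith
    then show "real (card U) = \<bar>sum f U\<bar> + 2 * real (min (card A) (card B))"
      by (simp only: sum card of_nat_add of_nat_min)
    have "min (card A) (card B) = 0 \<longleftrightarrow> card B = 0 \<or> card A = 0" by linarith
    then show "min (card A) (card B) = 0 \<longleftrightarrow> (\<forall>p\<in>U. f p = 1) \<or> (\<forall>p\<in>U. f p = - 1)"
      by (simp only: card_0_eq[OF AB(3)] card_0_eq[OF AB(4)] A_empty B_empty)
  qed
qed

lemma card_under_crossings:
  assumes D: "is_link_diagram D" and \<omega>: "is_orientation D \<omega>"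
    and ij: "i < ncomp D" "j < ncomp D" "i \<noteq> j"
  shows "\<exists>m::nat. real (card (under_crossings D i j)) = \<bar>linking_number D \<omega> i j\<bar> + 2 * real m \<and>
    (m = 0 \<longleftrightarrow> (\<forall>p\<in>under_crossings D i j. crossing_sign D \<omega> p = 1) \<or>
               (\<forall>p\<in>under_crossings D i j. crossing_sign D \<omega> p = - 1))"
  unfolding linking_number_eq_sum_under_crossings[OF D \<omega> ij]
proof (rule card_eq_abs_sum_signs)
  have sub: "under_crossings D i j \<subseteq> component D i \<inter> component D j"
    by (auto simp: under_crossings_def)
  show "finite (under_crossings D i j)"
    by (rule finite_subset[OF sub finite_mixed_crossings[OF D ij]])
  show "crossing_sign D \<omega> p = 1 \<or> crossing_sign D \<omega> p = - 1" if "p \<in> under_crossings D i j" for p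
    using crossing_sign_values[OF D \<omega> ij] that sub by blast
qed

section \<open>Base point sequences and orders of the components\<close>

lemma component_of_eqI:
  assumes D: "is_link_diagram D" and i: "i < ncomp D" and p: "p \<in> component D i" "p \<notin> crossings D"
  shows "component_of D p = i"
  unfolding component_of_def
  by (rule the_equality) (use crossing_of_components[OF D _ i _ _ p(1)] i p in blast)+

text \<open>
  Let \<open>\<kappa> i\<close> be the position of a base point on the component \<open>i\<close>. A base point is not a crossing, so it
  lies on only one component; hence \<open>\<kappa>\<close> is injective, by counting it is onto, and
  \<open>component_of\<close> inverts it.
\<close>

lemma bij_betw_component_of_base_points:
  assumes D: "is_link_diagram D" and a: "base_point_seq D a"
  shows "bij_betw (\<lambda>k. component_of D (a ! k)) {..<ncomp D} {..<ncomp D}"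
proof -
  have "\<exists>k. k < ncomp D \<and> a ! k \<in> component D i" if "i < ncomp D" for i
    using a that unfolding base_point_seq_def by blast
  then obtain \<kappa> where \<kappa>: "\<And>i. i < ncomp D \<Longrightarrow> \<kappa> i < ncomp D \<and> a ! \<kappa> i \<in> component D i"
    by metis
  have "component_of D (a ! \<kappa> i) = i" if "i < ncomp D" for i
    using \<kappa>[OF that] a by (intro component_of_eqI[OF D that]) (auto simp: base_point_seq_def)
  then have inv: "component_of D (a ! \<kappa> i) = i" if "i < ncomp D" for i using that by blast
  then have "inj_on \<kappa> {..<ncomp D}" by (metis inj_onI lessThan_iff)
  moreover have "\<kappa> ` {..<ncomp D} \<subseteq> {..<ncomp D}" using \<kappa> by auto
  ultimately have onto: "\<kappa> ` {..<ncomp D} = {..<ncomp D}" by (intro endo_inj_surj) auto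
  have "\<kappa> (component_of D (a ! k)) = k \<and> component_of D (a ! k) < ncomp D" if k: "k < ncomp D" for k
  proof -
    obtain i where i: "i < ncomp D" "k = \<kappa> i" using onto k by (metis imageE lessThan_iff)
    then show ?thesis using inv[OF i(1)] by simp
  qed
  then show ?thesis
    using inv onto by (intro bij_betw_byWitness[where f' = \<kappa>]) auto
qed

lemma ex_base_points_in_order:
  assumes D: "is_link_diagram D" and \<sigma>: "bij_betw \<sigma> {..<ncomp D} {..<ncomp D}"
  shows "\<exists>a. base_point_seq D a \<and> (\<forall>k < ncomp D. component_of D (a ! k) = \<sigma> k)"
proof -
  obtain a\<^sub>0 where a\<^sub>0: "base_point_seq D a\<^sub>0" using ex_base_point_seq[OF D] by blast
  have "\<exists>p. p \<in> component D i \<and> p \<notin> crossings D" if i: "i < ncomp D" for i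
  proof -
    obtain k where "k < ncomp D" "a\<^sub>0 ! k \<in> component D i"
      using a\<^sub>0 i unfolding base_point_seq_def by blast
    then show ?thesis using a\<^sub>0 by (auto simp: base_point_seq_def)
  qed
  then obtain f where f: "\<And>i. i < ncomp D \<Longrightarrow> f i \<in> component D i \<and> f i \<notin> crossings D"
    by metis
  have \<sigma>_less: "\<sigma> k < ncomp D" if "k < ncomp D" for k using bij_betwE[OF \<sigma>] that by auto
  define a where "a = map (\<lambda>k. f (\<sigma> k)) [0..<ncomp D]"
  have nth: "a ! k = f (\<sigma> k)" if "k < ncomp D" for k using that by (simp add: a_def)
  have comp: "component_of D (a ! k) = \<sigma> k" if "k < ncomp D" for k
    using f[OF \<sigma>_less[OF that]] by (simp add: nth[OF that] component_of_eqI[OF D \<sigma>_less[OF that]])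
  have "base_point_seq D a"
    unfolding base_point_seq_def
  proof (intro conjI allI impI)
    show "\<forall>p\<in>set a. p \<notin> crossings D" using f \<sigma>_less by (auto simp: a_def)
    fix i assume i: "i < ncomp D"
    obtain k where k: "k < ncomp D" "\<sigma> k = i"
      using \<sigma> i unfolding bij_betw_def by (metis imageE lessThan_iff)
    show "\<exists>!k. k < ncomp D \<and> a ! k \<in> component D i"
    proof (rule ex1I[of _ k])
      show "k < ncomp D \<and> a ! k \<in> component D i" using k f[OF i] by (simp add: nth)
      fix l assume l: "l < ncomp D \<and> a ! l \<in> component D i"
      then have "component_of D (a ! l) = i"
        using f[OF \<sigma>_less, of l] by (intro component_of_eqI[OF D i]) (auto simp: nth)
      then have "\<sigma> l = \<sigma> k" using comp l k by simp
      then show "l = k" using \<sigma> l k by (auto simp: bij_betw_def inj_on_def)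
    qed
  qed (simp add: a_def)
  then show ?thesis using comp by blast
qed

lemma double_sum_pairs:
  fixes h :: "nat \<Rightarrow> nat \<Rightarrow> real"
  assumes "\<And>i j. h i j = h j i" "\<And>i. h i i = 0"
  shows "(\<Sum>j<n. \<Sum>i<n. h i j) = 2 * (\<Sum>j<n. \<Sum>i<j. h i j)"
proof (induction n)
  case (Suc n)
  have "(\<Sum>j<n. h n j) = (\<Sum>i<n. h i n)" by (intro sum.cong refl assms(1))
  then show ?case using Suc assms(2) by (simp add: sum.distrib)
qed simp

text \<open>
  Both sides are half of the sum of \<open>h\<close> over all ordered pairs of distinct indices.
\<close>

lemma sum_pairs_permute:
  fixes h :: "nat \<Rightarrow> nat \<Rightarrow> real"
  assumes sym: "\<And>i j. h i j = h j i" and \<sigma>: "bij_betw \<sigma> {..<n} {..<n}"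
  shows "(\<Sum>j<n. \<Sum>i<j. h (\<sigma> i) (\<sigma> j)) = (\<Sum>j<n. \<Sum>i<j. h i j)"
proof -
  define h' where "h' i j = (if i = j then 0 else h i j)" for i j
  have h': "h' i j = h' j i" "h' i i = 0" for i j using sym by (auto simp: h'_def)
  have inj: "\<sigma> i = \<sigma> j \<longleftrightarrow> i = j" if "i < n" "j < n" for i j
    using \<sigma> that by (auto simp: bij_betw_def inj_on_def)
  have "2 * (\<Sum>j<n. \<Sum>i<j. h (\<sigma> i) (\<sigma> j)) = 2 * (\<Sum>j<n. \<Sum>i<j. h' (\<sigma> i) (\<sigma> j))"
    using inj by (auto intro!: sum.cong simp: h'_def)
  also have "\<dots> = (\<Sum>j<n. \<Sum>i<n. h' (\<sigma> i) (\<sigma> j))"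
    by (rule double_sum_pairs[symmetric]) (use h' in auto)
  also have "\<dots> = (\<Sum>j<n. \<Sum>i<n. h' i (\<sigma> j))"
    by (intro sum.cong refl sum.reindex_bij_betw[OF \<sigma>])
  also have "\<dots> = (\<Sum>j<n. \<Sum>i<n. h' i j)"
    by (rule sum.reindex_bij_betw[OF \<sigma>])
  also have "\<dots> = 2 * (\<Sum>j<n. \<Sum>i<j. h' i j)"
    by (rule double_sum_pairs) (use h' in auto)
  also have "(\<Sum>j<n. \<Sum>i<j. h' i j) = (\<Sum>j<n. \<Sum>i<j. h i j)"
    by (auto intro!: sum.cong simp: h'_def)
  finally show ?thesis by simp
qed

section \<open>Linking warping degree and linking numbers\<close>

text \<open>
  The linking warping degree depends on a base point sequence only through the order of the components
  that it induces. Since every order is induced by some sequence, \<open>ld D\<close> is the minimum of \<open>ld_order D \<sigma>\<close>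
  over all permutations \<open>\<sigma>\<close>.
\<close>

definition ld_order :: "link_diagram \<Rightarrow> (nat \<Rightarrow> nat) \<Rightarrow> nat" where
  "ld_order D \<sigma> = (\<Sum>j < ncomp D. \<Sum>i < j. card (under_crossings D (\<sigma> i) (\<sigma> j)))"

lemma ld_le_ld_order:
  assumes D: "is_link_diagram D" and \<sigma>: "bij_betw \<sigma> {..<ncomp D} {..<ncomp D}"
  shows "ld D \<le> ld_order D \<sigma>"
proof -
  obtain a where a: "base_point_seq D a" "\<And>k. k < ncomp D \<Longrightarrow> component_of D (a ! k) = \<sigma> k"
    using ex_base_points_in_order[OF D \<sigma>] by blast
  then have "ld_order D \<sigma> = ld_at D a" by (auto simp: ld_order_def ld_at_def intro!: sum.cong)
  then show ?thesis unfolding ld_def by (intro Least_le) (use a in blast)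
qed

lemma ld_eq_ld_order:
  assumes D: "is_link_diagram D"
  obtains \<sigma> where "bij_betw \<sigma> {..<ncomp D} {..<ncomp D}" "ld D = ld_order D \<sigma>"
proof -
  obtain a where a: "base_point_seq D a" "ld D = ld_at D a" using ld_attained[OF D] by blast
  show thesis
    by (rule that[OF bij_betw_component_of_base_points[OF D a(1)]])
       (simp add: a(2) ld_at_def ld_order_def)
qed

definition coherent_order :: "link_diagram \<Rightarrow> (nat \<Rightarrow> real) \<Rightarrow> (nat \<Rightarrow> nat) \<Rightarrow> bool" where
  "coherent_order D \<omega> \<sigma> \<longleftrightarrow> (\<forall>i j. i < j \<and> j < ncomp D \<longrightarrow>
     (\<forall>p \<in> under_crossings D (\<sigma> i) (\<sigma> j). crossing_sign D \<omega> p = 1) \<or>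
     (\<forall>p \<in> under_crossings D (\<sigma> i) (\<sigma> j). crossing_sign D \<omega> p = - 1))"

text \<open>
  This is \<open>card_under_crossings\<close>, summed over all pairs. The total linking number on the right does
  not see the order of the components, because linking numbers are symmetric.
\<close>

lemma ld_order_eq_linking_plus_even:
  assumes D: "is_link_diagram D" and \<omega>: "is_orientation D \<omega>"
    and \<sigma>: "bij_betw \<sigma> {..<ncomp D} {..<ncomp D}"
  obtains m :: nat where
    "real (ld_order D \<sigma>) = (\<Sum>j < ncomp D. \<Sum>i < j. \<bar>linking_number D \<omega> i j\<bar>) + 2 * real m"
    "m = 0 \<longleftrightarrow> coherent_order D \<omega> \<sigma>"
proof -
  define same where "same i j \<longleftrightarrow> (\<forall>p \<in> under_crossings D (\<sigma> i) (\<sigma> j). crossing_sign D \<omega> p = 1) \<or>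
       (\<forall>p \<in> under_crossings D (\<sigma> i) (\<sigma> j). crossing_sign D \<omega> p = - 1)" for i j
  have \<sigma>': "\<sigma> i < ncomp D" "\<sigma> j < ncomp D" "\<sigma> i \<noteq> \<sigma> j" if "i < j" "j < ncomp D" for i j
  proof -
    have "i \<in> {..<ncomp D}" "j \<in> {..<ncomp D}" "i \<noteq> j" using that by auto
    then show "\<sigma> i < ncomp D" "\<sigma> j < ncomp D" "\<sigma> i \<noteq> \<sigma> j"
      using bij_betwE[OF \<sigma>] inj_on_eq_iff[OF bij_betw_imp_inj_on[OF \<sigma>], of i j] by auto
  qed
  define m_spec where "m_spec i j m \<longleftrightarrow>
      real (card (under_crossings D (\<sigma> i) (\<sigma> j))) = \<bar>linking_number D \<omega> (\<sigma> i) (\<sigma> j)\<bar> + 2 * real m \<and>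
      (m = 0 \<longleftrightarrow> same i j)" for i j and m :: nat
  have "\<exists>m. m_spec i j m" if "i < j" "j < ncomp D" for i j
    unfolding m_spec_def same_def by (rule card_under_crossings[OF D \<omega> \<sigma>'[OF that]])
  then obtain m where m_spec: "\<And>i j. i < j \<Longrightarrow> j < ncomp D \<Longrightarrow> m_spec i j (m i j)"
    by metis
  note m = m_spec[unfolded m_spec_def, THEN conjunct1]
    and m_zero = m_spec[unfolded m_spec_def, THEN conjunct2]
  have "real (ld_order D \<sigma>) =
      (\<Sum>j < ncomp D. \<Sum>i < j. \<bar>linking_number D \<omega> (\<sigma> i) (\<sigma> j)\<bar> + 2 * real (m i j))"
    unfolding ld_order_def of_nat_sum by (intro sum.cong[OF refl] m) simp_all
  also have "\<dots> = (\<Sum>j < ncomp D. \<Sum>i < j. \<bar>linking_number D \<omega> (\<sigma> i) (\<sigma> j)\<bar>) +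
      2 * real (\<Sum>j < ncomp D. \<Sum>i < j. m i j)"
    by (simp add: sum.distrib sum_distrib_left)
  also have "(\<Sum>j < ncomp D. \<Sum>i < j. \<bar>linking_number D \<omega> (\<sigma> i) (\<sigma> j)\<bar>) =
      (\<Sum>j < ncomp D. \<Sum>i < j. \<bar>linking_number D \<omega> i j\<bar>)"
    by (rule sum_pairs_permute[OF _ \<sigma>]) (rule arg_cong[where f = abs], rule linking_number_commute)
  finally have eq: "real (ld_order D \<sigma>) = (\<Sum>j < ncomp D. \<Sum>i < j. \<bar>linking_number D \<omega> i j\<bar>) +
      2 * real (\<Sum>j < ncomp D. \<Sum>i < j. m i j)" .
  have "(\<Sum>j < ncomp D. \<Sum>i < j. m i j) = 0 \<longleftrightarrow> (\<forall>i j. i < j \<and> j < ncomp D \<longrightarrow> m i j = 0)"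
    by auto
  also have "\<dots> \<longleftrightarrow> (\<forall>i j. i < j \<and> j < ncomp D \<longrightarrow> same i j)"
    by (intro iff_allI imp_cong[OF refl]) (elim conjE, rule m_zero)
  also have "\<dots> \<longleftrightarrow> coherent_order D \<omega> \<sigma>" unfolding coherent_order_def same_def ..
  finally show thesis by (rule that[OF eq])
qed

theorem proposition4p1:
  fixes D :: link_diagram and \<omega> :: "nat \<Rightarrow> real"
  assumes "is_link_diagram D" and "is_orientation D \<omega>"
  shows
    "(\<Sum>j < ncomp D. \<Sum>i < j. \<bar>linking_number D \<omega> i j\<bar>) \<le> real (ld D) \<and>
     ((\<Sum>j < ncomp D. \<Sum>i < j. \<bar>linking_number D \<omega> i j\<bar>) = real (ld D) \<longleftrightarrow>
        (\<exists>\<sigma> \<omega>'. bij_betw \<sigma> {..<ncomp D} {..<ncomp D} \<and> is_orientation D \<omega>' \<and>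
           (\<forall>i j. i < j \<and> j < ncomp D \<longrightarrow>
              (\<forall>p \<in> under_crossings D (\<sigma> i) (\<sigma> j). crossing_sign D \<omega>' p = 1) \<or>
              (\<forall>p \<in> under_crossings D (\<sigma> i) (\<sigma> j). crossing_sign D \<omega>' p = -1)))) \<and>
     [(\<Sum>j < ncomp D. \<Sum>i < j. \<bar>linking_number D \<omega> i j\<bar>) = real (ld D)] (rmod 2)"
proof -
  note D = assms(1) and \<omega> = assms(2)
  let ?\<Lambda> = "\<Sum>j < ncomp D. \<Sum>i < j. \<bar>linking_number D \<omega> i j\<bar>"
  let ?coherent = "\<exists>\<sigma> \<omega>'. bij_betw \<sigma> {..<ncomp D} {..<ncomp D} \<and> is_orientation D \<omega>' \<and>
    coherent_order D \<omega>' \<sigma>"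
  obtain \<sigma> where \<sigma>: "bij_betw \<sigma> {..<ncomp D} {..<ncomp D}" "ld D = ld_order D \<sigma>"
    using ld_eq_ld_order[OF D] by blast
  obtain m :: nat where m: "real (ld D) = ?\<Lambda> + 2 * real m" "m = 0 \<longleftrightarrow> coherent_order D \<omega> \<sigma>"
    unfolding \<sigma>(2) by (rule ld_order_eq_linking_plus_even[OF D \<omega> \<sigma>(1)])
  have le: "?\<Lambda> \<le> real (ld D)" using m(1) by simp
  have eq: "?\<Lambda> = real (ld D) \<longleftrightarrow> ?coherent"
  proof
    assume "?\<Lambda> = real (ld D)"
    then have "m = 0" using m(1) by simp
    then show ?coherent using m(2) \<sigma>(1) \<omega> by blast
  next
    assume ?coherent
    then obtain \<tau> \<omega>' where \<tau>: "bij_betw \<tau> {..<ncomp D} {..<ncomp D}" and \<omega>': "is_orientation D \<omega>'"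
      and same: "coherent_order D \<omega>' \<tau>"
      by blast
    have "real (ld D) \<le> real (ld_order D \<tau>)" using ld_le_ld_order[OF D \<tau>] by simp
    also have "\<dots> = (\<Sum>j < ncomp D. \<Sum>i < j. \<bar>linking_number D \<omega>' i j\<bar>)"
      by (rule ld_order_eq_linking_plus_even[OF D \<omega>' \<tau>]) (use same in simp)
    also have "\<dots> = ?\<Lambda>"
      by (intro sum.cong refl abs_linking_number_reorient[OF D \<omega> \<omega>']) auto
    finally show "?\<Lambda> = real (ld D)" using le by simp
  qed
  have parity: "[?\<Lambda> = real (ld D)] (rmod 2)"
    unfolding rcong_altdef m(1) by (intro exI[of _ "int m"]) simp
  show ?thesis
    using le eq parity unfolding coherent_order_def by (intro conjI)
qed

end
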